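(* Let $(\Gamma,v_0)$ be a pointed graph satisfying the following two conditions: (S1) for every $i\in I(\Gamma,v_0)$ and all $v,w\in V$, $|S_i(v)|=|S_i(w)|$; (S2) for all $i,j,k\in I(\Gamma,v_0)$ and all $v,w\in S_k(v_0)$, $|S_i(v)\cap S_j(v_0)|=|S_i(w)\cap S_j(v_0)|$. Then the convolution $\circ$ of $H(\Gamma,v_0)$ is commutative if and only if $P_hD=DA_h$ (as maps $\mathbb{C}^V\to\mathbb{C}^{I(\Gamma,v_0)}$) for every $h\in I(\Gamma,v_0)$.
   Context: All graphs $\Gamma$, with vertex set $V$, are simple, connected, locally finite, self-centered (all vertices have the same eccentricity, possibly infinite), and have at most countably many (possibly infinitely many) vertices. $d$ is the graph distance on $V$. A pointed graph $(\Gamma,v_0)$ is a graph with a chosen base point $v_0\in V$. For $v\in V$ and $k\in\mathbb{N}_0$, $S_k(v)=\{w\in V: d(v,w)=k\}$. Put $I(\Gamma,v_0)=\{d(v_0,v): v\in V\}$, which equals $\{0,1,\dots,\mathrm{diam}(\Gamma)\}$ if $V$ is finite and $\mathbb{N}_0$ if $V$ is infinite. The (not necessarily associative) algebra $H(\Gamma,v_0)$: let $H(\Gamma,v_0)=\{x_i\}_{i\in I(\Gamma,v_0)}$ be a set of indeterminates and $\mathbb{C}H(\Gamma,v_0)$ the free complex vector space on it. Define a bilinear operation (convolution) $\circ$ on $\mathbb{C}H(\Gamma,v_0)$ by $x_i\circ x_j=\sum_{k\in I(\Gamma,v_0)}p_{i,j}^k x_k$, where $$p_{i,j}^k=\frac{1}{|S_i(v_0)|}\sum_{v\in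 S_i(v_0)}\frac{|S_j(v)\cap S_k(v_0)|}{|S_j(v)|}.$$ Matrices and maps: for a set $S$, $\mathbb{C}^S$ is the complex vector space of all families $(a_s)_{s\in S}$, $a_s\in\mathbb{C}$. For $k\in I(\Gamma,v_0)$, $A^{(k)}=(\delta_{k,d(x,y)})_{x,y\in V}$ ($\delta$ is the Kronecker delta), $\mu_k=|S_k(v_0)|$, $A_k=\frac{1}{\mu_k}A^{(k)}$, acting on $\mathbb{C}^V$ by $(A_k\bm{s})_x=\sum_{y\in V}A_k(x,y)s_y$ (finite sums by local finiteness). The $k$-transition matrix is $P_k=(p_{k,i}^j)_{i,j\in I(\Gamma,v_0)}$; it acts on column vectors through its transpose, i.e. for $\xi=(\xi_n)_n\in\mathbb{C}^{I(\Gamma,v_0)}$, $$P_k(\xi)=\Bigl(\sum_{l\in I(\Gamma,v_0)}p_{k,l}^n\,\xi_l\Bigr)_{n\in I(\Gamma,v_0)}$$ (a finite sum for each $n$, since $p_{k,l}^n=0$ when $|l-n|>k$). The linear map $D:\mathbb{C}^V\to\mathbb{C}^{I(\Gamma,v_0)}$ is $D(\bm{s})=\bigl(\sum_{v\in S_i(v_0)}s_v\bigr)_{i\in I(\Gamma,v_0)}$ for $\bm{s}=(s_v)_{v\in V}$. *)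

theory Defs
  imports
    Complex_Main
    "HOL-Library.Extended_Nat"
    "HOL-Library.FuncSet"
    "HOL-Library.Countable_Set"
    "HOL-Library.Poly_Mapping"
    "Graph_Theory.Graph_Theory"
begin

section \<open>Pointed graphs\<close>

definition gdist :: "'a pair_pre_digraph \<Rightarrow> 'a \<Rightarrow> 'a \<Rightarrow> nat" where
  "gdist G u v = (LEAST n. \<exists>p. pre_digraph.awalk (with_proj G) u p v \<and> length p = n)"

definition eccentricity :: "'a pair_pre_digraph \<Rightarrow> 'a \<Rightarrow> enat" where
  "eccentricity G v = (SUP w\<in>pverts G. enat (gdist G v w))"

text \<open>A simple graph is a symmetric loopfree digraph whose arcs are ordered pairs of vertices
  (\<^locale>\<open>pair_bidirected_digraph\<close>); its vertex set may be infinite.\<close>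

locale pointed_graph = pair_bidirected_digraph G
  for G :: "'a pair_pre_digraph" +
  fixes v0 :: 'a
  assumes base_point: "v0 \<in> pverts G"
    and countable_verts: "countable (pverts G)"
    and graph_connected: "Digraph_Component.connected (with_proj G)"
    and locally_finite: "\<And>v. v \<in> pverts G \<Longrightarrow> finite (out_arcs (with_proj G) v)"
    and self_centered:
      "\<And>v w. v \<in> pverts G \<Longrightarrow> w \<in> pverts G \<Longrightarrow> eccentricity G v = eccentricity G w"

definition gsphere :: "'a pair_pre_digraph \<Rightarrow> nat \<Rightarrow> 'a \<Rightarrow> 'a set" where
  "gsphere G k v = {w \<in> pverts G. gdist G v w = k}"

definition dist_range :: "'a pair_pre_digraph \<Rightarrow> 'a \<Rightarrow> nat set" where
  "dist_range G v0 = gdist G v0 ` pverts G"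

section \<open>The algebra\<close>

definition p_coeff :: "'a pair_pre_digraph \<Rightarrow> 'a \<Rightarrow> nat \<Rightarrow> nat \<Rightarrow> nat \<Rightarrow> complex" where
  "p_coeff G v0 i j k =
    1 / of_nat (card (gsphere G i v0)) *
    (\<Sum>v\<in>gsphere G i v0.
       of_nat (card (gsphere G j v \<inter> gsphere G k v0)) / of_nat (card (gsphere G j v)))"

text \<open>The free vector space on the indeterminates \<open>x\<^sub>i\<close>, with \<open>x\<^sub>i\<close> rendered as
  \<open>Poly_Mapping.single i 1\<close>. The multiplication that \<^typ>\<open>nat \<Rightarrow>\<^sub>0 complex\<close> already carries
  (that of polynomials) plays no role here.\<close>

definition CH :: "'a pair_pre_digraph \<Rightarrow> 'a \<Rightarrow> (nat \<Rightarrow>\<^sub>0 complex) set" where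
  "CH G v0 = {a. Poly_Mapping.keys a \<subseteq> dist_range G v0}"

text \<open>The sum over \<open>k\<close> is restricted to the non-zero structure constants because Isabelle's sum over
  an infinite index set is \<open>0\<close>. The same device is used for the sums in \<open>A_map\<close> and \<open>P_map\<close> below.
  Finiteness of the three restricted index sets is proved at the end of this theory.\<close>

definition convolution ::
    "'a pair_pre_digraph \<Rightarrow> 'a \<Rightarrow> (nat \<Rightarrow>\<^sub>0 complex) \<Rightarrow> (nat \<Rightarrow>\<^sub>0 complex) \<Rightarrow> (nat \<Rightarrow>\<^sub>0 complex)" where
  "convolution G v0 a b =
    (\<Sum>i\<in>Poly_Mapping.keys a. \<Sum>j\<in>Poly_Mapping.keys b.
       \<Sum>k | k \<in> dist_range G v0 \<and> p_coeff G v0 i j k \<noteq> 0.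
         Poly_Mapping.single k
           (Poly_Mapping.lookup a i * Poly_Mapping.lookup b j * p_coeff G v0 i j k))"

lemma convolution_generators:
  "convolution G v0 (Poly_Mapping.single i 1) (Poly_Mapping.single j 1) =
    (\<Sum>k | k \<in> dist_range G v0 \<and> p_coeff G v0 i j k \<noteq> 0.
       Poly_Mapping.single k (p_coeff G v0 i j k))"
  by (simp add: convolution_def)

section \<open>Matrices and linear maps\<close>

text \<open>The space of complex families indexed by \<open>S\<close>, as functions that are
  \<^const>\<open>undefined\<close> outside \<open>S\<close>.\<close>

abbreviation families :: "'i set \<Rightarrow> ('i \<Rightarrow> complex) set" where
  "families S \<equiv> S \<rightarrow>\<^sub>E UNIV"

definition dist_matrix :: "'a pair_pre_digraph \<Rightarrow> nat \<Rightarrow> 'a \<Rightarrow> 'a \<Rightarrow> complex" where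
  "dist_matrix G k x y = (if k = gdist G x y then 1 else 0)"

definition A_matrix :: "'a pair_pre_digraph \<Rightarrow> 'a \<Rightarrow> nat \<Rightarrow> 'a \<Rightarrow> 'a \<Rightarrow> complex" where
  "A_matrix G v0 k x y = 1 / of_nat (card (gsphere G k v0)) * dist_matrix G k x y"

definition A_map :: "'a pair_pre_digraph \<Rightarrow> 'a \<Rightarrow> nat \<Rightarrow> ('a \<Rightarrow> complex) \<Rightarrow> ('a \<Rightarrow> complex)" where
  "A_map G v0 k s =
    (\<lambda>x\<in>pverts G. \<Sum>y | y \<in> pverts G \<and> A_matrix G v0 k x y \<noteq> 0. A_matrix G v0 k x y * s y)"

definition P_matrix :: "'a pair_pre_digraph \<Rightarrow> 'a \<Rightarrow> nat \<Rightarrow> nat \<Rightarrow> nat \<Rightarrow> complex" where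
  "P_matrix G v0 k i j = p_coeff G v0 k i j"

text \<open>The transition matrix acts through its transpose.\<close>

definition P_map :: "'a pair_pre_digraph \<Rightarrow> 'a \<Rightarrow> nat \<Rightarrow> (nat \<Rightarrow> complex) \<Rightarrow> (nat \<Rightarrow> complex)" where
  "P_map G v0 k \<xi> =
    (\<lambda>n\<in>dist_range G v0. \<Sum>l | l \<in> dist_range G v0 \<and> P_matrix G v0 k l n \<noteq> 0. P_matrix G v0 k l n * \<xi> l)"

definition D_map :: "'a pair_pre_digraph \<Rightarrow> 'a \<Rightarrow> ('a \<Rightarrow> complex) \<Rightarrow> (nat \<Rightarrow> complex)" where
  "D_map G v0 s = (\<lambda>i\<in>dist_range G v0. \<Sum>v\<in>gsphere G i v0. s v)"

section \<open>Finiteness of the sums\<close>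

context pointed_graph
begin

lemma ex_awalk:
  assumes "u \<in> pverts G" "v \<in> pverts G"
  shows "\<exists>p. awalk u p v"
proof -
  have "mk_symmetric (with_proj G) = G"
    using pair_sym_arcs
    by (auto simp: mk_symmetric_def symmetric_def sym_def intro!: pair_pre_digraph.equality)
  then show ?thesis
    using graph_connected assms
    by (auto simp: Digraph_Component.connected_def strongly_connected_def reachable_awalk)
qed

lemma gdist_awalk:
  assumes "u \<in> pverts G" "v \<in> pverts G"
  obtains p where "awalk u p v" "length p = gdist G u v"
proof -
  have "\<exists>n p. awalk u p v \<and> length p = n"
    using ex_awalk[OF assms] by blast
  from LeastI_ex[OF this] show thesis
    using that by (auto simp: gdist_def)
qed

lemma gdist_le: "awalk u p v \<Longrightarrow> gdist G u v \<le> length p"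
  unfolding gdist_def by (rule Least_le) blast

lemma gdist_triangle:
  assumes "u \<in> pverts G" "v \<in> pverts G" "w \<in> pverts G"
  shows "gdist G u w \<le> gdist G u v + gdist G v w"
proof -
  obtain p q where "awalk u p v" "length p = gdist G u v" "awalk v q w" "length q = gdist G v w"
    using gdist_awalk assms by metis
  then show ?thesis
    using gdist_le[of u "p @ q" w] awalk_appendI by fastforce
qed

lemma gdist_commute:
  assumes "u \<in> pverts G" "v \<in> pverts G"
  shows "gdist G u v = gdist G v u"
proof -
  have rev: "awalk y (rev (map prod.swap p)) x" if "awalk x p y" for x y p
    using that
  proof (induction p arbitrary: x)
    case Nil
    then show ?case by (auto simp: awalk_Nil_iff)
  next
    case (Cons e p)
    then have e: "e \<in> parcs G" "fst e = x" and p: "awalk (snd e) p y"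
      by (auto simp: awalk_Cons_iff)
    have s: "prod.swap e \<in> parcs G"
      using e pair_sym_arcs by (cases e) (auto simp: symmetric_def sym_def)
    then have "awalk (snd e) [prod.swap e] x"
      using e by (cases e) (auto simp: awalk_Cons_iff awalk_Nil_iff dest: in_arcsD1 in_arcsD2)
    then show ?case
      using Cons.IH[OF p] awalk_appendI by fastforce
  qed
  have le: "gdist G y x \<le> gdist G x y" if xy: "x \<in> pverts G" "y \<in> pverts G" for x y
  proof -
    obtain p where p: "awalk x p y" "length p = gdist G x y"
      using gdist_awalk[OF xy] .
    then show ?thesis using gdist_le[OF rev[OF p(1)]] by simp
  qed
  show ?thesis using le[of u v] le[of v u] assms by simp
qed

lemma finite_gsphere:
  assumes "v \<in> pverts G"
  shows "finite (gsphere G k v)"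
proof -
  have fin: "finite {w. \<exists>p. awalk v p w \<and> length p = k}" for k
    using assms
  proof (induction k arbitrary: v)
    case 0
    then show ?case by (simp add: awalk_Nil_iff)
  next
    case (Suc k)
    have "{w. \<exists>p. awalk v p w \<and> length p = Suc k} \<subseteq>
        (\<Union>e\<in>out_arcs (with_proj G) v. {w. \<exists>p. awalk (snd e) p w \<and> length p = k})"
    proof
      fix w assume "w \<in> {w. \<exists>p. awalk v p w \<and> length p = Suc k}"
      then obtain e p where "awalk v (e # p) w" "length p = k"
        by (auto simp: length_Suc_conv)
      then show "w \<in> (\<Union>e\<in>out_arcs (with_proj G) v. {w. \<exists>p. awalk (snd e) p w \<and> length p = k})"
        by (intro UN_I[of e]) (auto simp: awalk_Cons_iff)
    qed
    moreover have "finite \<dots>"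
      using Suc locally_finite by (auto dest: in_arcsD2)
    ultimately show ?case by (rule finite_subset)
  qed
  have "gsphere G k v \<subseteq> {w. \<exists>p. awalk v p w \<and> length p = k}"
  proof
    fix w assume "w \<in> gsphere G k v"
    then show "w \<in> {w. \<exists>p. awalk v p w \<and> length p = k}"
      using gdist_awalk[OF assms, of w] by (auto simp: gsphere_def)
  qed
  then show ?thesis using fin finite_subset by blast
qed

lemma p_coeff_nonzeroE:
  assumes "p_coeff G v0 i j k \<noteq> 0"
  obtains v w where "v \<in> pverts G" "w \<in> pverts G"
    "gdist G v0 v = i" "gdist G v w = j" "gdist G v0 w = k"
proof -
  have "(\<Sum>v\<in>gsphere G i v0.
      of_nat (card (gsphere G j v \<inter> gsphere G k v0)) / of_nat (card (gsphere G j v)) :: complex) \<noteq> 0"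
    using assms by (auto simp: p_coeff_def)
  then obtain v where v: "v \<in> gsphere G i v0"
      "of_nat (card (gsphere G j v \<inter> gsphere G k v0)) / of_nat (card (gsphere G j v)) \<noteq> (0 :: complex)"
    by (rule sum.not_neutral_contains_not_neutral)
  then have "gsphere G j v \<inter> gsphere G k v0 \<noteq> {}" by auto
  then show thesis using v(1) that by (auto simp: gsphere_def)
qed

lemma finite_convolution_support: "finite {k \<in> dist_range G v0. p_coeff G v0 i j k \<noteq> 0}"
proof (rule finite_subset)
  show "{k \<in> dist_range G v0. p_coeff G v0 i j k \<noteq> 0} \<subseteq> {..i + j}"
    using gdist_triangle base_point by (auto elim!: p_coeff_nonzeroE)
qed simp

lemma finite_P_support: "finite {l \<in> dist_range G v0. P_matrix G v0 k l n \<noteq> 0}"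
proof (rule finite_subset)
  show "{l \<in> dist_range G v0. P_matrix G v0 k l n \<noteq> 0} \<subseteq> {..k + n}"
  proof
    fix l assume "l \<in> {l \<in> dist_range G v0. P_matrix G v0 k l n \<noteq> 0}"
    then have "p_coeff G v0 k l n \<noteq> 0" by (simp add: P_matrix_def)
    then obtain v w where "v \<in> pverts G" "w \<in> pverts G"
        "gdist G v0 v = k" "gdist G v w = l" "gdist G v0 w = n"
      by (rule p_coeff_nonzeroE)
    then show "l \<in> {..k + n}"
      using gdist_triangle[of v v0 w] gdist_commute[of v v0] base_point by simp
  qed
qed simp

lemma finite_A_support:
  assumes "x \<in> pverts G"
  shows "finite {y \<in> pverts G. A_matrix G v0 k x y \<noteq> 0}"
proof (rule finite_subset)
  show "{y \<in> pverts G. A_matrix G v0 k x y \<noteq> 0} \<subseteq> gsphere G k x"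
    by (auto simp: A_matrix_def dist_matrix_def gsphere_def split: if_splits)
qed (rule finite_gsphere[OF assms])

end

end

(* In the standard bases, the coefficient of s y in (P_h D s) n is p_{h,l}^n, where l = d(v0,y), and in
   (D A_h s) n it is |S_h(y) \<inter> S_n(v0)| / |S_h(v0)|. Under (S1) and (S2) the latter depends on y only
   through l, and averaging it over y in S_l(v0) gives p_{l,h}^n. So both conditions say that
   p_{h,l}^n = p_{l,h}^n for all h, l, n. *)
theory Submission
  imports Defs
begin

context pointed_graph
begin

lemma p_coeff_eq_0:
  assumes "k \<notin> dist_range G v0"
  shows "p_coeff G v0 i j k = 0"
  using assms p_coeff_nonzeroE[of i j k] unfolding dist_range_def by blast

text \<open>The finite support of the structure constants lets the innermost sum collapse to its
  term at \<open>k\<close>. The formula holds for every \<open>k\<close>, since outside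
  \<open>dist_range G v0\<close> both sides vanish.\<close>

lemma lookup_convolution:
  "Poly_Mapping.lookup (convolution G v0 a b) k =
    (\<Sum>i\<in>Poly_Mapping.keys a. \<Sum>j\<in>Poly_Mapping.keys b.
       Poly_Mapping.lookup a i * Poly_Mapping.lookup b j * p_coeff G v0 i j k)"
proof -
  have "(\<Sum>l | l \<in> dist_range G v0 \<and> p_coeff G v0 i j l \<noteq> 0.
          Poly_Mapping.lookup (Poly_Mapping.single l (c * p_coeff G v0 i j l)) k)
        = c * p_coeff G v0 i j k" for i j and c :: complex
    using finite_convolution_support[of i j] p_coeff_eq_0[of k i j]
    by (auto simp: lookup_single when_def sum.delta)
  then show ?thesis
    by (simp add: convolution_def lookup_sum)
qed

text \<open>By bilinearity it suffices to compare products of generators, whose coordinates are the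
  structure constants.\<close>

lemma convolution_commute_iff:
  "(\<forall>a\<in>CH G v0. \<forall>b\<in>CH G v0. convolution G v0 a b = convolution G v0 b a) \<longleftrightarrow>
    (\<forall>i\<in>dist_range G v0. \<forall>j\<in>dist_range G v0. \<forall>k\<in>dist_range G v0.
       p_coeff G v0 i j k = p_coeff G v0 j i k)" (is "?L \<longleftrightarrow> ?R")
proof
  assume L: ?L
  show ?R
  proof (intro ballI)
    fix i j k assume "i \<in> dist_range G v0" "j \<in> dist_range G v0"
    then have "convolution G v0 (Poly_Mapping.single i 1) (Poly_Mapping.single j 1) =
        convolution G v0 (Poly_Mapping.single j 1) (Poly_Mapping.single i 1)"
      using L by (simp add: CH_def)
    from arg_cong[OF this, of "\<lambda>c. Poly_Mapping.lookup c k"]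
    show "p_coeff G v0 i j k = p_coeff G v0 j i k"
      by (simp add: lookup_convolution)
  qed
next
  assume R: ?R
  show ?L
  proof (intro ballI poly_mapping_eqI)
    fix a b k assume ab: "a \<in> CH G v0" "b \<in> CH G v0"
    have "p_coeff G v0 i j k = p_coeff G v0 j i k"
      if "i \<in> Poly_Mapping.keys a" "j \<in> Poly_Mapping.keys b" for i j
      \<comment> \<open>\<open>R\<close> covers only \<open>k\<close> in the range; elsewhere both
        coefficients are 0.\<close>
      using R ab that by (cases "k \<in> dist_range G v0") (auto simp: CH_def p_coeff_eq_0)
    then show "Poly_Mapping.lookup (convolution G v0 a b) k = Poly_Mapping.lookup (convolution G v0 b a) k"
      unfolding lookup_convolution
      by (subst (2) sum.swap) (intro sum.cong, auto simp: mult_ac)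
  qed
qed

lemma finite_gball: "finite {y \<in> pverts G. gdist G v0 y \<le> r}"
proof -
  have "{y \<in> pverts G. gdist G v0 y \<le> r} = (\<Union>k\<in>{..r}. gsphere G k v0)"
    by (auto simp: gsphere_def)
  then show ?thesis using finite_gsphere[OF base_point] by simp
qed

text \<open>The spheres about \<open>v0\<close> partition the vertices, so the sum over
  \<open>l\<close> and then over the sphere of radius \<open>l\<close> is one sum over vertices.
  Only \<open>l \<le> h + n\<close> can contribute. The set \<open>B\<close> is left free so that
  both composites can be written over the same finite set, enlarged if needed.\<close>

lemma P_map_D_map:
  assumes n: "n \<in> dist_range G v0"
    and B: "finite B" "B \<subseteq> pverts G" "{y \<in> pverts G. gdist G v0 y \<le> h + n} \<subseteq> B"
  shows "P_map G v0 h (D_map G v0 s) n = (\<Sum>y\<in>B. p_coeff G v0 h (gdist G v0 y) n * s y)"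
proof -
  let ?T = "{l \<in> dist_range G v0. p_coeff G v0 h l n \<noteq> 0}"
  have fin: "finite ?T" using finite_P_support[of h n] by (simp add: P_matrix_def)
  have sub: "(\<Union>l\<in>?T. gsphere G l v0) \<subseteq> B"
  proof safe
    fix l y assume y: "y \<in> gsphere G l v0" and "p_coeff G v0 h l n \<noteq> 0"
    then obtain v w where "v \<in> pverts G" "w \<in> pverts G"
        "gdist G v0 v = h" "gdist G v w = l" "gdist G v0 w = n"
      by (elim p_coeff_nonzeroE)
    \<comment> \<open>Triangle inequality on the detour from \<open>v\<close> to \<open>w\<close>
      through \<open>v0\<close>.\<close>
    then have "l \<le> h + n"
      using gdist_triangle[of v v0 w] gdist_commute[of v v0] base_point by simp
    then show "y \<in> B" using y B(3) by (auto simp: gsphere_def)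
  qed
  have "P_map G v0 h (D_map G v0 s) n =
      (\<Sum>l\<in>?T. \<Sum>y\<in>gsphere G l v0. p_coeff G v0 h (gdist G v0 y) n * s y)"
    using n by (auto simp: P_map_def D_map_def P_matrix_def sum_distrib_left gsphere_def
      intro!: sum.cong)
  also have "\<dots> = (\<Sum>y\<in>(\<Union>l\<in>?T. gsphere G l v0). p_coeff G v0 h (gdist G v0 y) n * s y)"
    using fin finite_gsphere[OF base_point]
    by (intro sum.UNION_disjoint[symmetric]) (auto simp: gsphere_def)
  \<comment> \<open>A vertex of \<open>B\<close> outside the union has coefficient 0 by the choice
    of \<open>?T\<close>.\<close>
  also have "\<dots> = (\<Sum>y\<in>B. p_coeff G v0 h (gdist G v0 y) n * s y)"
    using B sub by (intro sum.mono_neutral_left) (auto simp: gsphere_def dist_range_def)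
  finally show ?thesis .
qed

text \<open>After exchanging the sums, the coefficient of \<open>s y\<close> is a column sum of the
  matrix over the sphere of radius \<open>n\<close>, which counts the vertices there at distance
  \<open>h\<close> from \<open>y\<close>.\<close>

lemma D_map_A_map:
  assumes n: "n \<in> dist_range G v0"
    and B: "finite B" "B \<subseteq> pverts G" "{y \<in> pverts G. gdist G v0 y \<le> h + n} \<subseteq> B"
  shows "D_map G v0 (A_map G v0 h s) n =
    (\<Sum>y\<in>B. of_nat (card (gsphere G h y \<inter> gsphere G n v0)) / of_nat (card (gsphere G h v0)) * s y)"
proof -
  have "A_map G v0 h s v = (\<Sum>y\<in>B. A_matrix G v0 h v y * s y)" if v: "v \<in> gsphere G n v0" for v
  proof -
    have vV: "v \<in> pverts G" using v by (simp add: gsphere_def)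
    have "y \<in> B" if y: "y \<in> pverts G" "A_matrix G v0 h v y \<noteq> 0" for y
    proof -
      have "gdist G v y = h"
        using y by (auto simp: A_matrix_def dist_matrix_def split: if_splits)
      then have "gdist G v0 y \<le> h + n"
        using gdist_triangle[OF base_point vV y(1)] v by (simp add: gsphere_def)
      then show ?thesis using B(3) y by auto
    qed
    then show ?thesis
      using vV B by (auto simp: A_map_def intro!: sum.mono_neutral_left)
  qed
  then have "D_map G v0 (A_map G v0 h s) n =
      (\<Sum>v\<in>gsphere G n v0. \<Sum>y\<in>B. A_matrix G v0 h v y * s y)"
    using n by (simp add: D_map_def)
  also have "\<dots> = (\<Sum>y\<in>B. (\<Sum>v\<in>gsphere G n v0. A_matrix G v0 h v y) * s y)"
    by (subst sum.swap) (simp add: sum_distrib_right)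
  also have "\<dots> = (\<Sum>y\<in>B. of_nat (card (gsphere G h y \<inter> gsphere G n v0)) /
      of_nat (card (gsphere G h v0)) * s y)"
  proof (rule sum.cong)
    fix y assume "y \<in> B"
    then have y: "y \<in> pverts G" using B by auto
    \<comment> \<open>Symmetry of the distance turns a condition on the row index \<open>v\<close>
      into a sphere about \<open>y\<close>.\<close>
    have "gsphere G n v0 \<inter> {v. h = gdist G v y} = gsphere G h y \<inter> gsphere G n v0"
      using gdist_commute[OF y] by (auto simp: gsphere_def)
    then have "(\<Sum>v\<in>gsphere G n v0. dist_matrix G h v y) =
        of_nat (card (gsphere G h y \<inter> gsphere G n v0))"
      using finite_gsphere[OF base_point, of n] by (simp add: dist_matrix_def sum.If_cases)
    then show "(\<Sum>v\<in>gsphere G n v0. A_matrix G v0 h v y) * s y =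
        of_nat (card (gsphere G h y \<inter> gsphere G n v0)) / of_nat (card (gsphere G h v0)) * s y"
      by (simp add: A_matrix_def sum_distrib_left[symmetric] sum_divide_distrib[symmetric])
  qed simp
  finally show ?thesis .
qed

text \<open>The coefficient is an average over a sphere of terms that the hypotheses make constant,
  hence equals their common value. The sphere contains \<open>y\<close>, so its size can be
  cancelled.\<close>

lemma p_coeff_eq_quotient:
  assumes "y \<in> pverts G"
    and sphere: "\<And>v. v \<in> pverts G \<Longrightarrow> card (gsphere G h v) = card (gsphere G h v0)"
    and inter: "\<And>v. v \<in> gsphere G (gdist G v0 y) v0 \<Longrightarrow>
      card (gsphere G h v \<inter> gsphere G n v0) = card (gsphere G h y \<inter> gsphere G n v0)"
  shows "p_coeff G v0 (gdist G v0 y) h n =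
    of_nat (card (gsphere G h y \<inter> gsphere G n v0)) / of_nat (card (gsphere G h v0))"
proof -
  let ?S = "gsphere G (gdist G v0 y) v0"
  have "(\<Sum>v\<in>?S. of_nat (card (gsphere G h v \<inter> gsphere G n v0)) / of_nat (card (gsphere G h v)) :: complex)
    = (\<Sum>v\<in>?S. of_nat (card (gsphere G h y \<inter> gsphere G n v0)) / of_nat (card (gsphere G h v0)))"
    by (rule sum.cong) (auto simp: inter sphere gsphere_def[of G "gdist G v0 y"])
  moreover have "card ?S \<noteq> 0"
    using assms(1) finite_gsphere[OF base_point] by (auto simp: gsphere_def card_eq_0_iff)
  ultimately show ?thesis by (simp add: p_coeff_def)
qed

text \<open>Both composites are, at each \<open>n\<close>, finite linear forms in the entries of
  \<open>s\<close>, so they agree for all \<open>s\<close> exactly when their coefficients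
  do.\<close>

lemma P_map_D_map_eq_iff:
  assumes quotient: "\<And>y n. \<lbrakk>y \<in> pverts G; n \<in> dist_range G v0\<rbrakk> \<Longrightarrow>
      p_coeff G v0 (gdist G v0 y) h n =
        of_nat (card (gsphere G h y \<inter> gsphere G n v0)) / of_nat (card (gsphere G h v0))"
  shows "compose (families (pverts G)) (P_map G v0 h) (D_map G v0) =
       compose (families (pverts G)) (D_map G v0) (A_map G v0 h) \<longleftrightarrow>
    (\<forall>l\<in>dist_range G v0. \<forall>n\<in>dist_range G v0. p_coeff G v0 h l n = p_coeff G v0 l h n)"
    (is "?L \<longleftrightarrow> ?R")
proof
  assume L: ?L
  show ?R
  proof (intro ballI)
    fix l n assume l: "l \<in> dist_range G v0" and n: "n \<in> dist_range G v0"
    then obtain y where y: "y \<in> pverts G" "l = gdist G v0 y" by (auto simp: dist_range_def)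
    \<comment> \<open>The vertex \<open>y\<close> is added because \<open>l\<close> may exceed
      \<open>h + n\<close>.\<close>
    define B where "B = insert y {y \<in> pverts G. gdist G v0 y \<le> h + n}"
    have B: "finite B" "B \<subseteq> pverts G" "{y \<in> pverts G. gdist G v0 y \<le> h + n} \<subseteq> B" "y \<in> B"
      using finite_gball y by (auto simp: B_def)
    \<comment> \<open>The standard basis vector at \<open>y\<close>, restricted so as to lie in
      \<open>families (pverts G)\<close>.\<close>
    define s :: "'a \<Rightarrow> complex" where "s = (\<lambda>x\<in>pverts G. if x = y then 1 else 0)"
    have coeff: "(\<Sum>x\<in>B. c x * s x) = c y" for c
    proof -
      have "(\<Sum>x\<in>B. c x * s x) = (\<Sum>x\<in>B. if x = y then c x else 0)"
        using B(2) by (intro sum.cong) (auto simp: s_def)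
      then show ?thesis using B by simp
    qed
    have "s \<in> families (pverts G)" by (simp add: s_def)
    then have "P_map G v0 h (D_map G v0 s) = D_map G v0 (A_map G v0 h s)"
      using fun_cong[OF L, of s] by (simp add: compose_def)
    from fun_cong[OF this, of n] show "p_coeff G v0 h l n = p_coeff G v0 l h n"
      unfolding P_map_D_map[OF n B(1-3)] D_map_A_map[OF n B(1-3)] coeff
      using quotient[OF y(1) n] y(2) by simp
  qed
next
  assume R: ?R
  have "P_map G v0 h (D_map G v0 s) n = D_map G v0 (A_map G v0 h s) n" for s n
  proof (cases "n \<in> dist_range G v0")
    case True
    show ?thesis
      unfolding P_map_D_map[OF True finite_gball Collect_restrict order_refl]
        D_map_A_map[OF True finite_gball Collect_restrict order_refl]
    proof (rule sum.cong[OF refl])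
      fix y assume "y \<in> {y \<in> pverts G. gdist G v0 y \<le> h + n}"
      then show "p_coeff G v0 h (gdist G v0 y) n * s y =
          of_nat (card (gsphere G h y \<inter> gsphere G n v0)) / of_nat (card (gsphere G h v0)) * s y"
        using R quotient[of y n] True by (auto simp: dist_range_def)
    qed
  \<comment> \<open>Outside \<open>dist_range G v0\<close> both sides are
    \<open>undefined\<close>.\<close>
  qed (simp add: P_map_def D_map_def)
  then have "P_map G v0 h (D_map G v0 s) = D_map G v0 (A_map G v0 h s)" for s by (rule ext)
  then show ?L by (simp add: compose_def)
qed

end

theorem theorem3p5:
  fixes G :: "'a pair_pre_digraph" and v0 :: 'a
  assumes "pointed_graph G v0"
    and S1: "\<forall>i\<in>dist_range G v0. \<forall>v\<in>pverts G. \<forall>w\<in>pverts G.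
      card (gsphere G i v) = card (gsphere G i w)"
    and S2: "\<forall>i\<in>dist_range G v0. \<forall>j\<in>dist_range G v0. \<forall>k\<in>dist_range G v0.
      \<forall>v\<in>gsphere G k v0. \<forall>w\<in>gsphere G k v0.
        card (gsphere G i v \<inter> gsphere G j v0) = card (gsphere G i w \<inter> gsphere G j v0)"
  shows "(\<forall>a\<in>CH G v0. \<forall>b\<in>CH G v0. convolution G v0 a b = convolution G v0 b a) \<longleftrightarrow>
    (\<forall>h\<in>dist_range G v0.
       compose (families (pverts G)) (P_map G v0 h) (D_map G v0) =
       compose (families (pverts G)) (D_map G v0) (A_map G v0 h))"
proof -
  interpret pointed_graph G v0 by fact
  \<comment> \<open>Here \<open>S1\<close> makes the denominators constant, and \<open>S2\<close>,
    taken at the sphere through \<open>y\<close>, the numerators.\<close>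
  have quotient: "p_coeff G v0 (gdist G v0 y) h n =
      of_nat (card (gsphere G h y \<inter> gsphere G n v0)) / of_nat (card (gsphere G h v0))"
    if "h \<in> dist_range G v0" "y \<in> pverts G" "n \<in> dist_range G v0" for h y n
  proof (rule p_coeff_eq_quotient)
    show "card (gsphere G h v) = card (gsphere G h v0)" if "v \<in> pverts G" for v
      using S1 base_point that \<open>h \<in> _\<close> by blast
    show "card (gsphere G h v \<inter> gsphere G n v0) = card (gsphere G h y \<inter> gsphere G n v0)"
      if "v \<in> gsphere G (gdist G v0 y) v0" for v
    proof -
      have "gdist G v0 y \<in> dist_range G v0" "y \<in> gsphere G (gdist G v0 y) v0"
        using \<open>y \<in> pverts G\<close> by (auto simp: dist_range_def gsphere_def)
      then show ?thesis using S2 that \<open>h \<in> _\<close> \<open>n \<in> _\<close> by blast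
    qed
  qed fact
  show ?thesis
    \<comment> \<open>Both sides become the symmetry of the structure constants in their first two
      indices.\<close>
    by (simp add: convolution_commute_iff P_map_D_map_eq_iff quotient)
qed

end
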